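(* Let $H$ be a finite Heyting algebra and let $M$ be a Heyting module over $H$. Then there is a one-one correspondence between $M^{\bigstar}$ and hereditary systems of submodules of $M$, under which $\phi\in M^{\bigstar}$ corresponds to the hereditary system $\mathcal K_\phi=\{K_c\}_{c\in H}$ with $K_c=\{m\in M : \phi(m)\le c\}$.
   Context: Lattices have all finite meets and joins (hence a least element $0$ and a greatest element $1$). A join semilattice is a poset in which every finite subset, including the empty one, has a join; its least element is $0$. For a distributive lattice $L$, a distributive module over $L$ is a join semilattice $M$ with an action $L\times M\to M$, $(x,m)\mapsto x\wedge m$, order preserving in both variables, such that $1\wedge m=m$, $0\wedge m=0$, $(x\wedge y)\wedge m=x\wedge(y\wedge m)$, $(x\vee y)\wedge m=(x\wedge m)\vee(y\wedge m)$, $x\wedge(m\vee n)=(x\wedge m)\vee(x\wedge n)$. Morphisms are maps preserving finite joins (including $0$) and satisfying $g(x\wedge m)=x\wedge g(m)$. A Heyting algebra $H$ is a lattice such that for all $y,z\in H$ there is $(y\to z)_H\in H$ with $x\wedge y\le z\Leftrightarrow x\le (y\to z)_H$ for all $x\in H$. A Heyting module over $H$ is a distributive module $M$ over $H$ such that for all $m,n\in M$ there is $(m\to n)_M\in H$ with $x\wedge m\le n\Leftrightarrow x\le(m\to n)_M$ for all $x\in H$; morphisms are morphisms of distributive modules. $M^{\bigstar}$ denotes the set of morphisms of Heyting modules $M\to H$. A hereditary submodule of $M$ is a sub-join-semilattice $N\subseteq M$ (closed under finite joins, containing $0$) such that $n\in N$ and $n'\le n$ imply $n'\in N$. For a hereditary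 submodule $K\subseteq M$ and $c\in H$ set $(K:c):=\{m\in M : c\wedge m\in K\}$, again a hereditary submodule. A hereditary system of submodules of $M$ is a family $\mathcal K=\{K_c\}_{c\in H}$ of hereditary submodules of $M$ such that for all $c,d\in H$: $K_c\cap K_d=K_{c\wedge d}$ and $(K_d:c)=K_{(c\to d)_H}$. *)

theory Defs
  imports Main
begin

(* The implication is uniquely determined by the adjunction, so making it an operation of the
   class adds no structure to the existence requirement. *)
class heyting_algebra = bounded_lattice +
  fixes himp :: "'a \<Rightarrow> 'a \<Rightarrow> 'a"  (infixr "\<rightarrow>\<^sub>H" 65)
  assumes le_himp_iff: "inf x y \<le> z \<longleftrightarrow> x \<le> (y \<rightarrow>\<^sub>H z)"
begin

subclass distrib_lattice
proof
  have *: "inf x (sup y z) \<le> sup (inf x y) (inf x z)" for x y z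
  proof -
    let ?r = "x \<rightarrow>\<^sub>H sup (inf x y) (inf x z)"
    have "y \<le> ?r" and "z \<le> ?r"
      by (simp_all add: le_himp_iff[symmetric] inf_commute)
    then have "sup y z \<le> ?r"
      by simp
    then show ?thesis
      by (simp add: le_himp_iff[symmetric] inf_commute)
  qed
  have "inf x (sup y z) = sup (inf x y) (inf x z)" for x y z
    by (rule order.antisym[OF *]) (simp add: le_infI2)
  then show "sup x (inf y z) = inf (sup x y) (sup x z)" for x y z
    by (rule distrib_imp1)
qed

end

locale distributive_module =
  fixes act :: "'h::{distrib_lattice, bounded_lattice} \<Rightarrow> 'm::bounded_semilattice_sup_bot \<Rightarrow> 'm"
  assumes act_mono: "x \<le> y \<Longrightarrow> m \<le> n \<Longrightarrow> act x m \<le> act y n"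
    and act_top: "act top m = m"
    and act_bot: "act bot m = bot"
    and act_act: "act (inf x y) m = act x (act y m)"
    and act_sup_left: "act (sup x y) m = sup (act x m) (act y m)"
    and act_sup_right: "act x (sup m n) = sup (act x m) (act x n)"

locale heyting_module = distributive_module act
  for act :: "'h::heyting_algebra \<Rightarrow> 'm::bounded_semilattice_sup_bot \<Rightarrow> 'm" +
  assumes ex_residual: "\<exists>r. \<forall>x. act x m \<le> n \<longleftrightarrow> x \<le> r"

lemma heyting_module_inf: "heyting_module (inf :: 'h::heyting_algebra \<Rightarrow> 'h \<Rightarrow> 'h)"
proof
  show "\<exists>r. \<forall>x. inf x m \<le> n \<longleftrightarrow> x \<le> r" for m n :: 'h
    using le_himp_iff by blast
qed (auto simp: inf_assoc inf_sup_distrib1 inf_sup_distrib2 intro: le_infI1 le_infI2)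

definition heyting_module_hom ::
    "('h::heyting_algebra \<Rightarrow> 'm::bounded_semilattice_sup_bot \<Rightarrow> 'm) \<Rightarrow>
     ('h \<Rightarrow> 'n::bounded_semilattice_sup_bot \<Rightarrow> 'n) \<Rightarrow> ('m \<Rightarrow> 'n) \<Rightarrow> bool"
  where "heyting_module_hom actM actN g \<longleftrightarrow>
    g bot = bot \<and>
    (\<forall>m n. g (sup m n) = sup (g m) (g n)) \<and>
    (\<forall>x m. g (actM x m) = actN x (g m))"

(* The algebra is regarded as a Heyting module over itself via inf, see heyting_module_inf. *)
definition heyting_dual ::
    "('h::heyting_algebra \<Rightarrow> 'm::bounded_semilattice_sup_bot \<Rightarrow> 'm) \<Rightarrow> ('m \<Rightarrow> 'h) set"
  where "heyting_dual act = {\<phi>. heyting_module_hom act inf \<phi>}"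

definition hereditary_submodule :: "'m::bounded_semilattice_sup_bot set \<Rightarrow> bool"
  where "hereditary_submodule N \<longleftrightarrow>
    bot \<in> N \<and>
    (\<forall>m\<in>N. \<forall>n\<in>N. sup m n \<in> N) \<and>
    (\<forall>n\<in>N. \<forall>n'. n' \<le> n \<longrightarrow> n' \<in> N)"

(* Written (K : c). *)
definition residual_submodule :: "('h \<Rightarrow> 'm \<Rightarrow> 'm) \<Rightarrow> 'm set \<Rightarrow> 'h \<Rightarrow> 'm set"
  where "residual_submodule act K c = {m. act c m \<in> K}"

definition hereditary_system ::
    "('h::heyting_algebra \<Rightarrow> 'm::bounded_semilattice_sup_bot \<Rightarrow> 'm) \<Rightarrow> ('h \<Rightarrow> 'm set) \<Rightarrow> bool"
  where "hereditary_system act K \<longleftrightarrow>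
    (\<forall>c. hereditary_submodule (K c)) \<and>
    (\<forall>c d. K c \<inter> K d = K (inf c d)) \<and>
    (\<forall>c d. residual_submodule act (K d) c = K (c \<rightarrow>\<^sub>H d))"

end

theory Submission
  imports Defs
begin

text \<open>
  Over a finite \<open>H\<close> the set \<open>{c. m \<in> K c}\<close>, which is closed under binary meets and
  nonempty because \<open>K (bot \<rightarrow>\<^sub>H top) = (K top : bot)\<close> is all of \<open>M\<close>, has a least element
  \<open>\<phi> m\<close>; thus \<open>m \<in> K c \<longleftrightarrow> \<phi> m \<le> c\<close>. Since an element of \<open>H\<close> is determined by its upper
  bounds, the closure properties of \<open>K\<close> translate into the morphism equations for \<open>\<phi>\<close>.
\<close>

lemma heyting_module_hom_mono:
  assumes "heyting_module_hom actM actN g" "m \<le> n"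
  shows "g m \<le> g n"
  using assms unfolding heyting_module_hom_def by (metis sup.absorb_iff2)

text \<open>Joins, \<open>bot\<close> and monotonicity of \<open>\<phi>\<close> make each sublevel
  set hereditary. The intersection law is the universal property of \<open>inf\<close>, and the
  residual law is the adjunction for \<open>\<rightarrow>\<^sub>H\<close> after rewriting
  \<open>\<phi> (act c m)\<close> as \<open>inf c (\<phi> m)\<close>.\<close>

lemma hereditary_system_of_hom:
  fixes act :: "'h::heyting_algebra \<Rightarrow> 'm::bounded_semilattice_sup_bot \<Rightarrow> 'm"
  assumes "heyting_module_hom act inf \<phi>"
  shows "hereditary_system act (\<lambda>c. {m. \<phi> m \<le> c})"
proof -
  note eqs = assms[unfolded heyting_module_hom_def]
  have "hereditary_submodule {m. \<phi> m \<le> c}" for c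
    using eqs heyting_module_hom_mono[OF assms]
    by (auto simp: hereditary_submodule_def intro: order_trans)
  moreover have "\<phi> (act c m) \<le> d \<longleftrightarrow> \<phi> m \<le> (c \<rightarrow>\<^sub>H d)" for c d m
    using eqs by (simp add: le_himp_iff[symmetric] inf_commute)
  ultimately show ?thesis
    by (auto simp: hereditary_system_def residual_submodule_def)
qed

lemma hereditary_system_eq_sublevel:
  fixes act :: "'h::{heyting_algebra, finite} \<Rightarrow> 'm::bounded_semilattice_sup_bot \<Rightarrow> 'm"
  assumes "distributive_module act" and K: "hereditary_system act K"
  obtains \<phi> where "\<And>m c. m \<in> K c \<longleftrightarrow> \<phi> m \<le> c"
proof -
  have inter: "K c \<inter> K d = K (inf c d)" for c d
    using K by (simp add: hereditary_system_def)
  have "\<exists>a. \<forall>c. m \<in> K c \<longleftrightarrow> a \<le> c" for m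
  proof -
    have "bot \<in> K top" and "residual_submodule act (K top) bot = K (bot \<rightarrow>\<^sub>H top)"
      using K by (auto simp: hereditary_system_def hereditary_submodule_def)
    then have "m \<in> K (bot \<rightarrow>\<^sub>H top)"
      using distributive_module.act_bot[OF assms(1)] by (auto simp: residual_submodule_def)
    then obtain a where a: "m \<in> K a" "\<And>c. m \<in> K c \<Longrightarrow> c \<le> a \<Longrightarrow> a = c"
      using finite_has_minimal[of "{c. m \<in> K c}"] by auto
    \<comment> \<open>Minimal becomes least: \<open>m\<close> also lies in
      \<open>K (inf a c)\<close>, so minimality forces \<open>a = inf a c\<close>.\<close>
    have "a \<le> c" if "m \<in> K c" for c
      using a(2)[of "inf a c"] a(1) that inter[of a c] by (metis IntI inf_le1 inf_le2)
    \<comment> \<open>The intersection law makes \<open>K\<close> monotone: here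
      \<open>K a \<inter> K c = K a\<close>.\<close>
    moreover have "m \<in> K c" if "a \<le> c" for c
      using a(1) inter[of a c] that by (metis IntE inf_absorb1)
    ultimately show ?thesis by blast
  qed
  then obtain \<phi> where "\<forall>m c. m \<in> K c \<longleftrightarrow> \<phi> m \<le> c"
    by metis
  then show ?thesis
    using that by blast
qed

lemma hom_of_hereditary_system:
  fixes act :: "'h::heyting_algebra \<Rightarrow> 'm::bounded_semilattice_sup_bot \<Rightarrow> 'm"
  assumes K: "hereditary_system act K" and \<phi>: "\<And>m c. m \<in> K c \<longleftrightarrow> \<phi> m \<le> c"
  shows "heyting_module_hom act inf \<phi>"
proof -
  have sub: "hereditary_submodule (K c)" for c
    using K by (simp add: hereditary_system_def)
  have "\<phi> bot \<le> bot"
    using sub[of bot] by (simp add: hereditary_submodule_def \<phi>)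
  moreover have "\<phi> (sup m n) = sup (\<phi> m) (\<phi> n)" for m n
  proof (rule order.antisym)
    \<comment> \<open>Both \<open>m\<close> and \<open>n\<close> lie in \<open>K\<close> at the
      index \<open>sup (\<phi> m) (\<phi> n)\<close>, which is closed under joins.\<close>
    show "\<phi> (sup m n) \<le> sup (\<phi> m) (\<phi> n)"
      using sub[of "sup (\<phi> m) (\<phi> n)"] by (simp add: hereditary_submodule_def \<phi>)
    \<comment> \<open>Now \<open>sup m n\<close> lies in \<open>K (\<phi> (sup m n))\<close>, hence
      so do the smaller \<open>m\<close> and \<open>n\<close>.\<close>
    show "sup (\<phi> m) (\<phi> n) \<le> \<phi> (sup m n)"
      using sub[of "\<phi> (sup m n)"] unfolding hereditary_submodule_def
      by (metis \<phi> order_refl sup_ge1 sup_ge2 sup_least)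
  qed
  moreover have "\<phi> (act x m) = inf x (\<phi> m)" for x m
  proof -
    \<comment> \<open>Both sides have the same upper bounds \<open>d\<close>: the residual law moves
      \<open>x\<close> across to \<open>x \<rightarrow>\<^sub>H d\<close>, and the adjunction brings
      it back as a meet.\<close>
    have "\<phi> (act x m) \<le> d \<longleftrightarrow> inf x (\<phi> m) \<le> d" for d
    proof -
      have "residual_submodule act (K d) x = K (x \<rightarrow>\<^sub>H d)"
        using K by (simp add: hereditary_system_def)
      then have "\<phi> (act x m) \<le> d \<longleftrightarrow> \<phi> m \<le> (x \<rightarrow>\<^sub>H d)"
        by (simp add: residual_submodule_def \<phi> set_eq_iff)
      then show ?thesis
        by (simp add: le_himp_iff[symmetric] inf_commute)
    qed
    then show ?thesis
      by (metis order.antisym order_refl)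
  qed
  ultimately show ?thesis
    by (simp add: heyting_module_hom_def bot_unique)
qed

theorem proposition4p5:
  fixes act :: "'h::{heyting_algebra, finite} \<Rightarrow> 'm::bounded_semilattice_sup_bot \<Rightarrow> 'm"
  assumes "heyting_module act"
  shows "bij_betw (\<lambda>\<phi> c. {m. \<phi> m \<le> c}) (heyting_dual act) {K. hereditary_system act K}"
proof (rule bij_betw_imageI)
  show "inj_on (\<lambda>\<phi> c. {m. \<phi> m \<le> c}) (heyting_dual act)"
  proof (rule inj_onI)
    fix \<phi> \<psi> :: "'m \<Rightarrow> 'h"
    assume "(\<lambda>c. {m. \<phi> m \<le> c}) = (\<lambda>c. {m. \<psi> m \<le> c})"
    then have "\<phi> m \<le> c \<longleftrightarrow> \<psi> m \<le> c" for m c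
      by (simp add: fun_eq_iff set_eq_iff)
    \<comment> \<open>Taking \<open>c\<close> to be \<open>\<phi> m\<close> and then
      \<open>\<psi> m\<close> gives the two inequalities.\<close>
    then show "\<phi> = \<psi>"
      by (metis ext order.antisym order_refl)
  qed
  have "K \<in> (\<lambda>\<phi> c. {m. \<phi> m \<le> c}) ` heyting_dual act" if K: "hereditary_system act K" for K
  proof -
    obtain \<phi> where \<phi>: "\<And>m c. m \<in> K c \<longleftrightarrow> \<phi> m \<le> c"
      using hereditary_system_eq_sublevel[OF heyting_module.axioms(1)[OF assms] K] by blast
    then have "K = (\<lambda>c. {m. \<phi> m \<le> c})"
      by auto
    then show ?thesis
      using hom_of_hereditary_system[OF K \<phi>] by (auto simp: heyting_dual_def)
  qed
  then show "(\<lambda>\<phi> c. {m. \<phi> m \<le> c}) ` heyting_dual act = {K. hereditary_system act K}"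
    using hereditary_system_of_hom by (auto simp: heyting_dual_def)
qed

end
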